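(* Let $\hat L$ be any monotonic joint loss function, $\mathcal{C}$ any family of classifiers $c:\mathcal{X}\to\{0,1\}$, and $A$ any optimal learner for $\mathcal{C}$. Then, on any training data $\langle x_i,y_i\rangle_{i=1}^n$, the procedure Decouple returns a classifier in $\gamma(\mathcal{C})$ of minimal joint loss $\hat L$ on the training data, i.e., its output $\gamma_{\vec c}$ satisfies $$\hat L\bigl(\langle g_i,y_i,\gamma_{\vec c}(x_i)\rangle_{i=1}^n\bigr)=\min_{\gamma\in\gamma(\mathcal{C})}\hat L\bigl(\langle g_i,y_i,\gamma(x_i)\rangle_{i=1}^n\bigr).$$ Moreover, for constant $K$, Decouple runs in time linear in the time to run $A$ and polynomial in the number of examples $n$ and in the time to evaluate $\hat L$ and classifiers $c\in\mathcal{C}$.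
   Context: Setting. The examples are partitioned by group, $\mathcal{X}=\mathcal{X}_1\cup\dots\cup\mathcal{X}_K$; $g(x)$ is the index of the group of $x$ and $g_i=g(x_i)$. Labels and classifications are binary: $\mathcal{Y}=\mathcal{Z}=\{0,1\}$. Write $[K]=\{1,\dots,K\}$ and $S^*$ for the set of finite sequences of elements of $S$. For $\vec c=(c_1,\dots,c_K)\in\mathcal{C}^K$, the decoupled classifier is $\gamma_{\vec c}(x)=c_{g(x)}(x)$, and $\gamma(\mathcal{C})=\{\gamma_{\vec c}\mid\vec c\in\mathcal{C}^K\}$. Joint loss and monotonicity. A joint loss is a function $\hat L:([K]\times\mathcal{Y}\times\mathcal{Z})^*\to\mathbb{R}$. For a sequence $\langle g_i,y_i,z_i\rangle_{i=1}^n$ let $n_k=|\{i: g_i=k\}|$ (all groups are assumed to be represented in the data, $n_k\ge1$), $\hat p_k=\frac1n\sum_{i:g_i=k}z_i$ (the vector $(\hat p_1,\dots,\hat p_K)$ is the profile), and $\hat\ell_k=\frac1{n_k}\sum_{i:g_i=k}|z_i-y_i|$. The joint loss $\hat L$ is monotonic if, for any fixed $\langle g_i,y_i\rangle_{i=1}^n\in([K]\times\mathcal{Y})^*$, $\hat L$ can be written (as a function of the $z_i$) as $h(\langle\hat\ell_k,\hat p_k\rangle_{k=1}^K)$, where $h:[0,1]^{2K}\to\mathbb{R}$ is nondecreasing in each $\hat\ell_k$ when all its other inputs are fixed. Learners. A $\mathcal{C}$-learning algorithm is a map $A:(\mathcal{X}\times\mathcal{Y})^*\to2^{\mathcal{C}}$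 which on input $\langle x_i,y_i\rangle_{i=1}^m$ returns one or more classifiers from $\mathcal{C}$ such that any two distinct returned classifiers $c,c'$ have $\sum_ic(x_i)\ne\sum_ic'(x_i)$. $A$ is optimal if, for every achievable number of positives $P\in\{\sum_ic(x_i)\mid c\in\mathcal{C}\}$, it outputs exactly one classifier with exactly $P$ positive classifications on its input, and this classifier has minimal error $\sum_i|y_i-c(x_i)|$ among all classifiers in $\mathcal{C}$ with exactly $P$ positive classifications. Procedure Decouple, on input $A,\hat L,\langle x_i,y_i\rangle_{i=1}^n,\mathcal{X}_1,\dots,\mathcal{X}_K$: for each $k=1,\dots,K$ compute $C_k=A(\langle x_i,y_i\rangle_{i:x_i\in\mathcal{X}_k})$; then, by exhaustive search over $C_1\times\dots\times C_K$, return $\gamma_{\vec c}$ for a $\vec c\in C_1\times\dots\times C_K$ minimizing $\hat L(\langle g_i,y_i,\gamma_{\vec c}(x_i)\rangle_{i=1}^n)$. *)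

theory Defs
  imports Complex_Main "HOL-Library.FuncSet" "HOL-Library.Disjoint_Sets" "HOL-Library.Monad_Syntax"
begin

section \<open>Groups, classifiers and joint losses\<close>

text \<open>
  The type \<open>'x\<close> is the set of examples; \<open>bool\<close> is \<open>{0, 1}\<close> and
  \<open>of_bool\<close> gives numerical values. Groups are numbered from 1 to \<open>K\<close>.
\<close>

type_synonym 'x classifier = "'x \<Rightarrow> bool"
type_synonym 'x sample = "('x \<times> bool) list"
type_synonym datum = "nat \<times> bool \<times> bool"
type_synonym joint_loss = "datum list \<Rightarrow> real"

definition grouping :: "nat \<Rightarrow> (nat \<Rightarrow> 'x set) \<Rightarrow> bool" where
  "grouping K X \<longleftrightarrow> disjoint_family_on X {1..K} \<and> (\<Union>k\<in>{1..K}. X k) = UNIV"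

definition group :: "nat \<Rightarrow> (nat \<Rightarrow> 'x set) \<Rightarrow> 'x \<Rightarrow> nat" where
  "group K X x = (THE k. k \<in> {1..K} \<and> x \<in> X k)"

definition decoupled :: "nat \<Rightarrow> (nat \<Rightarrow> 'x set) \<Rightarrow> (nat \<Rightarrow> 'x classifier) \<Rightarrow> 'x classifier" where
  "decoupled K X c = (\<lambda>x. c (group K X x) x)"

definition decoupled_classifiers ::
  "nat \<Rightarrow> (nat \<Rightarrow> 'x set) \<Rightarrow> 'x classifier set \<Rightarrow> 'x classifier set" where
  "decoupled_classifiers K X C = decoupled K X ` ({1..K} \<rightarrow>\<^sub>E C)"

definition records :: "nat \<Rightarrow> (nat \<Rightarrow> 'x set) \<Rightarrow> 'x sample \<Rightarrow> 'x classifier \<Rightarrow> datum list" where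
  "records K X S c = map (\<lambda>(x, y). (group K X x, y, c x)) S"

definition in_group :: "nat \<Rightarrow> datum list \<Rightarrow> datum list" where
  "in_group k s = filter (\<lambda>(g, y, z). g = k) s"

definition profile :: "nat \<Rightarrow> datum list \<Rightarrow> real" where
  "profile k s = (\<Sum>(g, y, z)\<leftarrow>in_group k s. of_bool z) / real (length s)"

definition group_loss :: "nat \<Rightarrow> datum list \<Rightarrow> real" where
  "group_loss k s =
     (\<Sum>(g, y, z)\<leftarrow>in_group k s. \<bar>of_bool z - of_bool y\<bar>) / real (length (in_group k s))"

text \<open>
  The function \<open>h\<close> may depend on the fixed groups and labels \<open>gys\<close>, but not on the
  classifications. As usual, only sequences in which every group occurs are considered, since
  otherwise some \<open>group_loss k s\<close> is undefined (here: \<open>0 / 0\<close>).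
\<close>

definition monotonic :: "nat \<Rightarrow> joint_loss \<Rightarrow> bool" where
  "monotonic K L \<longleftrightarrow>
     (\<forall>gys :: (nat \<times> bool) list. fst ` set gys = {1..K} \<longrightarrow>
       (\<exists>h :: (nat \<Rightarrow> real \<times> real) \<Rightarrow> real.
         (\<forall>s. map (\<lambda>(g, y, z). (g, y)) s = gys \<longrightarrow>
              L s = h (\<lambda>k\<in>{1..K}. (group_loss k s, profile k s))) \<and>
         (\<forall>v \<in> {1..K} \<rightarrow>\<^sub>E {0..1} \<times> {0..1}. \<forall>k\<in>{1..K}. \<forall>l\<in>{fst (v k)..1}.
              h v \<le> h (v(k := (l, snd (v k)))))))"


section \<open>Learners\<close>

definition positives :: "'x sample \<Rightarrow> 'x classifier \<Rightarrow> nat" where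
  "positives S c = (\<Sum>(x, y)\<leftarrow>S. of_bool (c x))"

definition errors :: "'x sample \<Rightarrow> 'x classifier \<Rightarrow> int" where
  "errors S c = (\<Sum>(x, y)\<leftarrow>S. \<bar>of_bool y - of_bool (c x)\<bar>)"

definition learner :: "'x classifier set \<Rightarrow> ('x sample \<Rightarrow> 'x classifier set) \<Rightarrow> bool" where
  "learner C A \<longleftrightarrow>
     (\<forall>S. A S \<noteq> {} \<and> A S \<subseteq> C \<and>
          (\<forall>c\<in>A S. \<forall>c'\<in>A S. c \<noteq> c' \<longrightarrow> positives S c \<noteq> positives S c'))"

definition optimal_learner :: "'x classifier set \<Rightarrow> ('x sample \<Rightarrow> 'x classifier set) \<Rightarrow> bool" where
  "optimal_learner C A \<longleftrightarrow> learner C A \<and>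
     (\<forall>S. \<forall>P \<in> positives S ` C.
        (\<exists>!c. c \<in> A S \<and> positives S c = P) \<and>
        (\<forall>c \<in> A S. positives S c = P \<longrightarrow>
           (\<forall>c'\<in>C. positives S c' = P \<longrightarrow> errors S c \<le> errors S c')))"


section \<open>Computations with running times\<close>

text \<open>
  A nondeterministic computation is the set of its runs, each consisting of a result and a number
  of steps. A call of the learner, of the loss, or of a classifier takes the number of steps given
  by a function of its arguments. The remaining costs are those of a random access machine: a loop
  iteration, a membership test, an array access, an extension of a sequence at its end and a
  comparison of two loss values take one step each.
\<close>

type_synonym 'a computation = "('a \<times> nat) set"

definition run_bind :: "'a computation \<Rightarrow> ('a \<Rightarrow> 'b computation) \<Rightarrow> 'b computation" where
  "run_bind m f = {(b, s + t) | a b s t. (a, s) \<in> m \<and> (b, t) \<in> f a}"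

adhoc_overloading Monad_Syntax.bind \<rightleftharpoons> run_bind

definition steps :: "nat \<Rightarrow> 'a \<Rightarrow> 'a computation" where
  "steps t a = {(a, t)}"

primrec foreach :: "'a list \<Rightarrow> ('a \<Rightarrow> 's \<Rightarrow> 's computation) \<Rightarrow> 's \<Rightarrow> 's computation" where
  "foreach [] body s = steps 0 s"
| "foreach (a # as) body s = do {
     s' \<leftarrow> body a s;
     s'' \<leftarrow> steps 1 s';
     foreach as body s''
   }"


section \<open>The procedure Decouple\<close>

text \<open>The set returned by the learner is received as a list, in an arbitrary order.\<close>

definition call_learner ::
  "('x sample \<Rightarrow> 'x classifier set) \<Rightarrow> ('x sample \<Rightarrow> nat) \<Rightarrow> 'x sample \<Rightarrow> 'x classifier list computation"
where
  "call_learner A tA S = {(cs, tA S) | cs. distinct cs \<and> set cs = A S}"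

definition group_sample :: "'x set \<Rightarrow> 'x sample \<Rightarrow> 'x sample" where
  "group_sample Xk S = filter (\<lambda>(x, y). x \<in> Xk) S"

definition split_off :: "'x set \<Rightarrow> 'x sample \<Rightarrow> 'x sample computation" where
  "split_off Xk S = foreach S (\<lambda>(x, y) D. do {
     b \<leftarrow> steps 1 (x \<in> Xk);
     if b then steps 1 (D @ [(x, y)]) else steps 0 D
   }) []"

definition learn_groups ::
  "nat \<Rightarrow> (nat \<Rightarrow> 'x set) \<Rightarrow> ('x sample \<Rightarrow> 'x classifier set) \<Rightarrow> ('x sample \<Rightarrow> nat) \<Rightarrow> 'x sample
   \<Rightarrow> (nat \<Rightarrow> 'x classifier list) computation" where
  "learn_groups K X A tA S = foreach [1..<Suc K] (\<lambda>k Cs. do {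
     D \<leftarrow> split_off (X k) S;
     cs \<leftarrow> call_learner A tA D;
     steps 1 (Cs(k := cs))
   }) (\<lambda>_. [])"

text \<open>The group of an example is found by testing it for membership in each of the \<open>K\<close> groups.\<close>

definition classify ::
  "nat \<Rightarrow> (nat \<Rightarrow> 'x set) \<Rightarrow> ('x classifier \<Rightarrow> 'x \<Rightarrow> nat) \<Rightarrow> 'x sample \<Rightarrow> (nat \<Rightarrow> 'x classifier)
   \<Rightarrow> datum list computation" where
  "classify K X tC S c = foreach S (\<lambda>(x, y) s. do {
     g \<leftarrow> steps K (group K X x);
     c' \<leftarrow> steps 1 (c g);
     z \<leftarrow> steps (tC c' x) (c' x);
     steps 1 (s @ [(g, y, z)])
   }) []"

text \<open>
  The state of the search is the best candidate seen so far, with its loss. Ties are broken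
  arbitrarily. Copying a candidate, an array of length \<open>K\<close>, takes \<open>K\<close> steps.
\<close>

definition try_candidate ::
  "nat \<Rightarrow> (nat \<Rightarrow> 'x set) \<Rightarrow> joint_loss \<Rightarrow> (datum list \<Rightarrow> nat) \<Rightarrow> ('x classifier \<Rightarrow> 'x \<Rightarrow> nat)
   \<Rightarrow> 'x sample \<Rightarrow> (nat \<Rightarrow> 'x classifier) \<Rightarrow> ((nat \<Rightarrow> 'x classifier) \<times> real) option
   \<Rightarrow> ((nat \<Rightarrow> 'x classifier) \<times> real) option computation" where
  "try_candidate K X L tL tC S c best = do {
     s \<leftarrow> classify K X tC S c;
     v \<leftarrow> steps (tL s) (L s);
     (case best of
        None \<Rightarrow> steps K (Some (c, v))
      | Some (c0, v0) \<Rightarrow> do {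
          cmp \<leftarrow> steps 1 (v < v0, v = v0);
          (if fst cmp then steps K (Some (c, v))
           else if snd cmp then steps 0 best \<union> steps K (Some (c, v))
           else steps 0 best)
        })
   }"

primrec search ::
  "((nat \<Rightarrow> 'c) \<Rightarrow> 's \<Rightarrow> 's computation) \<Rightarrow> (nat \<Rightarrow> 'c list) \<Rightarrow> nat list \<Rightarrow> (nat \<Rightarrow> 'c) \<Rightarrow> 's
   \<Rightarrow> 's computation" where
  "search body Cs [] c s = body c s"
| "search body Cs (k # ks) c s = do {
     cs \<leftarrow> steps 1 (Cs k);
     foreach cs (\<lambda>a s'. do {
       c' \<leftarrow> steps 1 (c(k := a));
       search body Cs ks c' s'
     }) s
   }"

definition decouple ::
  "nat \<Rightarrow> (nat \<Rightarrow> 'x set) \<Rightarrow> joint_loss \<Rightarrow> (datum list \<Rightarrow> nat) \<Rightarrow> ('x classifier \<Rightarrow> 'x \<Rightarrow> nat)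
   \<Rightarrow> ('x sample \<Rightarrow> 'x classifier set) \<Rightarrow> ('x sample \<Rightarrow> nat) \<Rightarrow> 'x sample
   \<Rightarrow> 'x classifier computation" where
  "decouple K X L tL tC A tA S = do {
     Cs \<leftarrow> learn_groups K X A tA S;
     best \<leftarrow> search (try_candidate K X L tL tC S) Cs [1..<Suc K] (\<lambda>_. undefined) None;
     steps 1 (decoupled K X (fst (the best)))
   }"


section \<open>Polynomials in three variables\<close>

definition poly3 :: "nat \<Rightarrow> (nat \<Rightarrow> nat \<Rightarrow> nat \<Rightarrow> nat) \<Rightarrow> nat \<Rightarrow> nat \<Rightarrow> nat \<Rightarrow> nat" where
  "poly3 d q u v w = (\<Sum>i\<le>d. \<Sum>j\<le>d. \<Sum>l\<le>d. q i j l * u ^ i * v ^ j * w ^ l)"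

end

theory Submission
  imports Defs
begin

text \<open>
  Fix \<open>f : {1..K} \<rightarrow> C\<close>. Replacing each \<open>f k\<close> by the classifier that the optimal learner returns on
  group \<open>k\<close> for the same number of positives leaves the profile unchanged and does not increase any
  group loss, hence does not increase a monotonic joint loss. So the minimum over the product of the
  learner's outputs, which the exhaustive search finds, is the minimum over all decoupled classifiers.
  As the learner's classifiers have distinct numbers of positives, it returns at most \<open>n + 1\<close> of them
  for each group, and the search tries at most \<open>(n + 1)^K\<close> candidates.
\<close>

section \<open>Reasoning about computations\<close>

text \<open>A Hoare triple for total correctness with a time budget. Requiring that a run exists
  excludes vacuous truth and later yields that \<open>decouple\<close> has a result.\<close>

definition runs_within :: "'a computation \<Rightarrow> nat \<Rightarrow> ('a \<Rightarrow> bool) \<Rightarrow> bool" where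
  "runs_within m t Q \<longleftrightarrow> m \<noteq> {} \<and> (\<forall>(a, s)\<in>m. Q a \<and> s \<le> t)"

lemma runs_withinD: "runs_within m t Q \<Longrightarrow> (a, s) \<in> m \<Longrightarrow> Q a \<and> s \<le> t"
  by (auto simp: runs_within_def)

lemma runs_within_steps: "Q a \<Longrightarrow> t \<le> u \<Longrightarrow> runs_within (steps t a) u Q"
  by (simp add: runs_within_def steps_def)

lemma runs_within_union:
  "runs_within m t Q \<Longrightarrow> runs_within m' t Q \<Longrightarrow> runs_within (m \<union> m') t Q"
  by (auto simp: runs_within_def)

lemma runs_within_mono:
  "runs_within m t P \<Longrightarrow> t \<le> u \<Longrightarrow> (\<And>a. P a \<Longrightarrow> Q a) \<Longrightarrow> runs_within m u Q"
  by (fastforce simp: runs_within_def)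

lemma runs_within_bind:
  assumes "runs_within m s P" and "\<And>a. P a \<Longrightarrow> runs_within (f a) t Q" and "s + t \<le> u"
  shows "runs_within (run_bind m f) u Q"
proof -
  obtain a s0 where a: "(a, s0) \<in> m" "P a"
    using assms(1) by (fastforce simp: runs_within_def)
  then obtain b t0 where "(b, t0) \<in> f a"
    using assms(2)[of a] by (fastforce simp: runs_within_def)
  with a have "run_bind m f \<noteq> {}"
    unfolding run_bind_def by blast
  moreover have "Q b \<and> r \<le> u" if "(b, r) \<in> run_bind m f" for b r
  proof -
    obtain a s1 t1 where r: "r = s1 + t1" "(a, s1) \<in> m" "(b, t1) \<in> f a"
      using \<open>(b, r) \<in> run_bind m f\<close> by (auto simp: run_bind_def)
    then have "P a" "s1 \<le> s"
      using assms(1) by (auto simp: runs_within_def)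
    moreover from this have "Q b" "t1 \<le> t"
      using assms(2)[of a] r by (auto simp: runs_within_def)
    ultimately show ?thesis
      using r assms(3) by simp
  qed
  ultimately show ?thesis
    by (auto simp: runs_within_def)
qed

lemma runs_within_bind_steps:
  "runs_within (f a) t Q \<Longrightarrow> s + t \<le> u \<Longrightarrow> runs_within (run_bind (steps s a) f) u Q"
  by (rule runs_within_bind[where P = "(=) a"]) (auto intro: runs_within_steps)

text \<open>Passing on the exact remainder \<open>u - s\<close> leaves no unknown budget, so that
  automation can walk through a chain of \<open>steps\<close>.\<close>

lemma runs_within_bind_steps_diff:
  "s \<le> u \<Longrightarrow> runs_within (f a) (u - s) Q \<Longrightarrow> runs_within (run_bind (steps s a) f) u Q"
  by (rule runs_within_bind_steps[where t = "u - s"]) simp_all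

text \<open>The loop rule. The invariant sees the list of elements already processed, so it can say
  what has been computed from them; the \<open>+ 1\<close> is the step that \<open>foreach\<close>
  charges per iteration.\<close>

lemma runs_within_foreach:
  assumes "\<And>ys x s. x \<in> set xs \<Longrightarrow> I ys s \<Longrightarrow> runs_within (body x s) t (I (ys @ [x]))"
    and "I ys s"
  shows "runs_within (foreach xs body s) (length xs * (t + 1)) (I (ys @ xs))"
  using assms
proof (induction xs arbitrary: ys s)
  case Nil
  then show ?case by (simp add: runs_within_steps)
next
  case (Cons x xs)
  have "runs_within (body x s) t (I (ys @ [x]))"
    using Cons.prems by simp
  moreover have "runs_within (run_bind (steps 1 s') (foreach xs body))
      (1 + length xs * (t + 1)) (I (ys @ x # xs))" if "I (ys @ [x]) s'" for s'
    using Cons.IH[OF Cons.prems(1) that] by (intro runs_within_bind_steps) auto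
  ultimately show ?case
    unfolding foreach.simps by (rule runs_within_bind) simp_all
qed


section \<open>Exhaustive search\<close>

text \<open>The candidates that \<open>search\<close> reaches from the partial assignment
  \<open>c\<close> while the coordinates \<open>ks\<close> are still to be chosen.\<close>

definition completions :: "(nat \<Rightarrow> 'c list) \<Rightarrow> nat list \<Rightarrow> (nat \<Rightarrow> 'c) \<Rightarrow> (nat \<Rightarrow> 'c) set" where
  "completions Cs ks c =
     {f. (\<forall>k\<in>set ks. f k \<in> set (Cs k)) \<and> (\<forall>k. k \<notin> set ks \<longrightarrow> f k = c k)}"

lemma completions_Nil: "completions Cs [] c = {c}"
  by (auto simp: completions_def)

text \<open>One level of the search tree. Since \<open>k\<close> does not recur in
  \<open>ks\<close>, the value chosen for it survives the deeper levels.\<close>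

lemma completions_Cons:
  assumes "k \<notin> set ks"
  shows "completions Cs (k # ks) c = (\<Union>a\<in>set (Cs k). completions Cs ks (c(k := a)))"
proof (intro set_eqI iffI)
  fix f
  assume "f \<in> completions Cs (k # ks) c"
  then have "f k \<in> set (Cs k)" "f \<in> completions Cs ks (c(k := f k))"
    by (auto simp: completions_def)
  then show "f \<in> (\<Union>a\<in>set (Cs k). completions Cs ks (c(k := a)))"
    by blast
next
  fix f
  assume "f \<in> (\<Union>a\<in>set (Cs k). completions Cs ks (c(k := a)))"
  then show "f \<in> completions Cs (k # ks) c"
    using assms by (auto simp: completions_def split: if_splits)
qed

text \<open>The initial value \<open>undefined\<close> is exactly what the extensional product
  prescribes off the index set, so the two sets of functions agree literally.\<close>

lemma completions_upt_undefined:
  "completions Cs [1..<Suc K] (\<lambda>_. undefined) = (\<Pi>\<^sub>E k\<in>{1..K}. set (Cs k))"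
proof -
  have "set [1..<Suc K] = {1..K}"
    by auto
  then show ?thesis
    unfolding completions_def PiE_def Pi_def extensional_def by blast
qed

text \<open>The first argument of the invariant \<open>J\<close> is the set of candidates tried so far.\<close>

lemma runs_within_search:
  assumes "distinct ks" and "\<And>k. k \<in> set ks \<Longrightarrow> length (Cs k) \<le> M" and "1 \<le> M"
    and "\<And>V f s. f \<in> completions Cs ks c \<Longrightarrow> J V s \<Longrightarrow> runs_within (body f s) B (J (insert f V))"
    and "J V s"
  shows "runs_within (search body Cs ks c s) (M ^ length ks * (B + 3 * length ks))
           (J (V \<union> completions Cs ks c))"
  using assms
proof (induction ks arbitrary: c V s)
  case Nil
  then show ?case by (simp add: completions_Nil)
next
  case (Cons k ks)
  let ?T = "M ^ length ks * (B + 3 * length ks)"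
  let ?W = "\<lambda>a. completions Cs ks (c(k := a))"
  have W: "completions Cs (k # ks) c = (\<Union>a\<in>set (Cs k). ?W a)"
    using Cons.prems(1) by (simp add: completions_Cons)
  \<comment> \<open>Invariant of the loop at this level: the subtrees of the entries
    \<open>as\<close> handled so far have been added to \<open>V\<close>.\<close>
  have "runs_within (run_bind (steps 1 (c(k := a))) (\<lambda>c'. search body Cs ks c' s')) (1 + ?T)
      (J (V \<union> \<Union> (?W ` set (as @ [a]))))"
    if "a \<in> set (Cs k)" "J (V \<union> \<Union> (?W ` set as)) s'" for as a s'
  proof -
    have "runs_within (search body Cs ks (c(k := a)) s') ?T (J ((V \<union> \<Union> (?W ` set as)) \<union> ?W a))"
    proof (rule Cons.IH)
      show "runs_within (body f s) B (J (insert f V))"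
        if "f \<in> ?W a" "J V s" for V f s
        using that Cons.prems(4) \<open>a \<in> set (Cs k)\<close> W by blast
    qed (use Cons.prems that in auto)
    moreover have "(V \<union> \<Union> (?W ` set as)) \<union> ?W a = V \<union> \<Union> (?W ` set (as @ [a]))"
      by auto
    ultimately show ?thesis
      by (intro runs_within_bind_steps[where t = ?T]) simp_all
  qed
  then have "runs_within
      (foreach (Cs k) (\<lambda>a s'. run_bind (steps 1 (c(k := a))) (\<lambda>c'. search body Cs ks c' s')) s)
      (length (Cs k) * (1 + ?T + 1)) (J (V \<union> \<Union> (?W ` set ([] @ Cs k))))"
    by (rule runs_within_foreach[where I = "\<lambda>as. J (V \<union> \<Union> (?W ` set as))"])
      (use Cons.prems in auto)
  \<comment> \<open>Each entry costs an array update and a loop step besides its subtree, and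
    reading the list costs one more step. As \<open>1 \<le> M\<close>, these extras are at most
    \<open>3 * M\<close>, hence at most \<open>3 * M ^ length (k # ks)\<close>: this is where the 3
    per level comes from.\<close>
  moreover have "1 + length (Cs k) * (1 + ?T + 1) \<le> M ^ length (k # ks) * (B + 3 * length (k # ks))"
  proof -
    have "length (Cs k) * (1 + ?T + 1) \<le> M * (1 + ?T + 1)"
      using Cons.prems(2) by (intro mult_right_mono) auto
    then have "1 + length (Cs k) * (1 + ?T + 1) \<le> 1 + M * 2 + M * ?T"
      by (simp add: algebra_simps)
    also have "\<dots> \<le> M * 3 + M * ?T"
      using Cons.prems(3) by simp
    also have "\<dots> \<le> M * M ^ length ks * 3 + M * ?T"
      using Cons.prems(3) by simp
    finally show ?thesis
      by (simp add: algebra_simps)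
  qed
  ultimately show ?case
    unfolding search.simps by (intro runs_within_bind_steps) (auto simp: W)
qed


section \<open>Monotonic joint losses\<close>

lemma group_in:
  assumes "grouping K X"
  shows "group K X x \<in> {1..K}" and "x \<in> X (group K X x)"
proof -
  obtain j where j: "j \<in> {1..K}" "x \<in> X j"
    using assms unfolding grouping_def by (metis UNIV_I UN_E)
  have "i = j" if "i \<in> {1..K} \<and> x \<in> X i" for i
    using assms that j disjoint_family_onD[of X "{1..K}" i j]
    unfolding grouping_def by (metis IntI empty_iff)
  then have "group K X x = j"
    unfolding group_def using j by (intro the_equality) simp_all
  with j show "group K X x \<in> {1..K}" "x \<in> X (group K X x)"
    by simp_all
qed

lemma group_eq_iff:
  assumes "grouping K X" and "k \<in> {1..K}"
  shows "group K X x = k \<longleftrightarrow> x \<in> X k"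
proof
  assume "x \<in> X k"
  then show "group K X x = k"
    using assms group_in[OF assms(1), of x] disjoint_family_onD[of X "{1..K}" "group K X x" k]
    unfolding grouping_def by (metis IntI empty_iff)
qed (use group_in[OF assms(1), of x] in simp)

text \<open>On group \<open>k\<close> the decoupled classifier acts as \<open>f k\<close>, so this
  part of the records depends on that one component. Hence the components can be replaced
  independently of each other.\<close>

lemma in_group_records:
  assumes "grouping K X" "k \<in> {1..K}"
  shows "in_group k (records K X S (decoupled K X f)) =
    map (\<lambda>(x, y). (k, y, f k x)) (group_sample (X k) S)"
proof (induction S)
  case Nil
  then show ?case by (simp add: in_group_def records_def group_sample_def)
next
  case (Cons p S)
  obtain x y where "p = (x, y)" by (cases p)
  with Cons group_eq_iff[OF assms, of x] show ?case
    by (auto simp: in_group_def records_def group_sample_def decoupled_def)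
qed

lemma group_loss_records:
  assumes "grouping K X" "k \<in> {1..K}"
  shows "group_loss k (records K X S (decoupled K X f)) =
    real_of_int (errors (group_sample (X k) S) (f k)) / real (length (group_sample (X k) S))"
proof -
  have "(\<Sum>(g, y, z)\<leftarrow>map (\<lambda>(x, y). (k, y, f k x)) D. \<bar>of_bool z - of_bool y\<bar>) =
      real_of_int (errors D (f k))" for D
    by (induction D) (auto simp: errors_def)
  then show ?thesis
    by (simp add: group_loss_def in_group_records[OF assms])
qed

lemma profile_records:
  assumes "grouping K X" "k \<in> {1..K}"
  shows "profile k (records K X S (decoupled K X f)) =
    real (positives (group_sample (X k) S) (f k)) / real (length S)"
proof -
  have "(\<Sum>(g, y, z)\<leftarrow>map (\<lambda>(x, y). (k, y, f k x)) D. of_bool z) = real (positives D (f k))" for D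
    by (induction D) (auto simp: positives_def)
  then show ?thesis
    by (simp add: profile_def in_group_records[OF assms]) (simp add: records_def)
qed

lemma positives_le_length: "positives D c \<le> length D"
  by (induction D) (auto simp: positives_def)

lemma errors_nonneg: "0 \<le> errors D c"
  by (induction D) (auto simp: errors_def)

lemma errors_le_length: "errors D c \<le> int (length D)"
  by (induction D) (auto simp: errors_def)

text \<open>The function \<open>h\<close> is monotone in one loss at a time, so \<open>v\<close> is
  transformed into \<open>w\<close> one group at a time, staying inside the box throughout.\<close>

lemma mono_all_losses:
  fixes h :: "(nat \<Rightarrow> real \<times> real) \<Rightarrow> real"
  assumes h: "\<And>v k l. v \<in> I \<rightarrow>\<^sub>E {0..1} \<times> {0..1} \<Longrightarrow> k \<in> I \<Longrightarrow> l \<in> {fst (v k)..1} \<Longrightarrow>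
      h v \<le> h (v(k := (l, snd (v k))))"
    and "finite I" and v: "v \<in> I \<rightarrow>\<^sub>E {0..1} \<times> {0..1}" and w: "w \<in> I \<rightarrow>\<^sub>E {0..1} \<times> {0..1}"
    and vw: "\<And>k. k \<in> I \<Longrightarrow> fst (v k) \<le> fst (w k) \<and> snd (v k) = snd (w k)"
  shows "h v \<le> h w"
proof -
  \<comment> \<open>The hybrid point that has already been switched to \<open>w\<close> on
    \<open>J\<close>; it leads from \<open>v\<close> at the empty set to \<open>w\<close> at
    \<open>I\<close>.\<close>
  define u where "u J = (\<lambda>k. if k \<in> J then w k else v k)" for J
  have "h v \<le> h (u J)" if "J \<subseteq> I" for J
    using finite_subset[OF that \<open>finite I\<close>] that
  proof (induction J rule: finite_induct)
    case empty
    then show ?case by (simp add: u_def)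
  next
    case (insert k J)
    have k: "k \<in> I" using insert.prems by simp
    have uk: "u J k = v k" using insert.hyps by (simp add: u_def)
    have "u J \<in> I \<rightarrow>\<^sub>E {0..1} \<times> {0..1}"
      unfolding PiE_iff extensional_def
    proof (intro conjI ballI CollectI allI impI)
      show "u J i \<in> {0..1} \<times> {0..1}" if "i \<in> I" for i
        using that PiE_mem[OF v that] PiE_mem[OF w that] by (simp add: u_def)
      show "u J i = undefined" if "i \<notin> I" for i
        using PiE_arb[OF v that] PiE_arb[OF w that] by (simp add: u_def)
    qed
    moreover have "fst (w k) \<in> {fst (u J k)..1}"
      using PiE_mem[OF w k] vw[OF k] uk by (auto simp: mem_Times_iff)
    ultimately have "h (u J) \<le> h ((u J)(k := (fst (w k), snd (u J k))))"
      using k by (intro h)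
    \<comment> \<open>The second components agree at \<open>k\<close>, so replacing the loss alone
      already gives \<open>w k\<close>.\<close>
    moreover have "(u J)(k := (fst (w k), snd (u J k))) = u (insert k J)"
    proof
      fix i
      show "((u J)(k := (fst (w k), snd (u J k)))) i = u (insert k J) i"
        using vw[OF k] uk by (cases "i = k") (simp_all add: u_def)
    qed
    ultimately show ?case
      using insert by simp
  qed
  from this[of I] have "h v \<le> h (u I)"
    by simp
  also have "u I = w"
  proof
    show "u I i = w i" for i
      using PiE_arb[OF v] PiE_arb[OF w] by (cases "i \<in> I") (simp_all add: u_def)
  qed
  finally show ?thesis .
qed

text \<open>Groups and labels are common to both lists of records, so a single \<open>h\<close>
  evaluates both. Passing from \<open>f\<close> to \<open>f'\<close> fixes the profile and lowers no
  group loss.\<close>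

lemma joint_loss_mono:
  assumes g: "grouping K X" and mon: "monotonic K L"
    and ne: "\<And>k. k \<in> {1..K} \<Longrightarrow> group_sample (X k) S \<noteq> []"
    and pos: "\<And>k. k \<in> {1..K} \<Longrightarrow>
      positives (group_sample (X k) S) (f k) = positives (group_sample (X k) S) (f' k)"
    and err: "\<And>k. k \<in> {1..K} \<Longrightarrow>
      errors (group_sample (X k) S) (f k) \<le> errors (group_sample (X k) S) (f' k)"
  shows "L (records K X S (decoupled K X f)) \<le> L (records K X S (decoupled K X f'))"
proof -
  define gys where "gys = map (\<lambda>(x, y). (group K X x, y)) S"
  \<comment> \<open>Nonempty group samples bring the data within the scope of
    \<open>monotonic\<close>.\<close>
  have "fst ` set gys = {1..K}"
  proof
    show "fst ` set gys \<subseteq> {1..K}"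
      using group_in(1)[OF g] by (auto simp: gys_def simp del: atLeastAtMost_iff)
    show "{1..K} \<subseteq> fst ` set gys"
    proof
      fix k
      assume k: "k \<in> {1..K}"
      with ne obtain p where "p \<in> set (group_sample (X k) S)"
        by (meson list.set_sel(1))
      then obtain x y where xy: "(x, y) \<in> set S" "x \<in> X k"
        by (auto simp: group_sample_def)
      then have "k = group K X x"
        using group_eq_iff[OF g k, of x] by simp
      with xy show "k \<in> fst ` set gys"
        by (force simp: gys_def)
    qed
  qed
  from mon[unfolded monotonic_def, THEN spec, THEN mp, OF this] obtain h where h: "(\<forall>s. map (\<lambda>(g, y, z). (g, y)) s = gys \<longrightarrow>
        L s = h (\<lambda>k\<in>{1..K}. (group_loss k s, profile k s))) \<and>
      (\<forall>v \<in> {1..K} \<rightarrow>\<^sub>E {0..1} \<times> {0..1}. \<forall>k\<in>{1..K}. \<forall>l\<in>{fst (v k)..1}.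
        h v \<le> h (v(k := (l, snd (v k)))))"
    ..
  define r where "r f = records K X S (decoupled K X f)" for f
  define v where "v f = (\<lambda>k\<in>{1..K}. (group_loss k (r f), profile k (r f)))" for f
  have Lv: "L (r f) = h (v f)" for f
    unfolding v_def by (rule h[THEN conjunct1, rule_format]) (auto simp: r_def gys_def records_def)
  \<comment> \<open>Monotonicity of \<open>h\<close> is given on the unit box only, so the points of
    evaluation have to be located there.\<close>
  have v_in: "v f \<in> {1..K} \<rightarrow>\<^sub>E {0..1} \<times> {0..1}" for f
  proof -
    have "group_loss k (r f) \<in> {0..1}" "profile k (r f) \<in> {0..1}" if k: "k \<in> {1..K}" for k
    proof -
      let ?D = "group_sample (X k) S"
      have "real_of_int (errors ?D (f k)) \<le> real (length ?D)"
        using errors_le_length[of ?D "f k"] by linarith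
      then show "group_loss k (r f) \<in> {0..1}"
        using errors_nonneg[of ?D "f k"] ne[OF k]
        by (simp add: r_def group_loss_records[OF g k])
      have "length ?D \<le> length S"
        by (simp add: group_sample_def)
      then have "positives ?D (f k) \<le> length S"
        using positives_le_length[of ?D "f k"] by linarith
      moreover have "S \<noteq> []"
        using ne[OF k] by (auto simp: group_sample_def)
      ultimately show "profile k (r f) \<in> {0..1}"
        by (simp add: r_def profile_records[OF g k])
    qed
    then show ?thesis
      unfolding v_def by auto
  qed
  have "h (v f) \<le> h (v f')"
  proof (rule mono_all_losses[where I = "{1..K}"])
    show "fst (v f k) \<le> fst (v f' k) \<and> snd (v f k) = snd (v f' k)" if k: "k \<in> {1..K}" for k
      using k pos[OF k] err[OF k]
      by (simp add: v_def r_def group_loss_records[OF g k] profile_records[OF g k] divide_right_mono)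
    show "h u \<le> h (u(k := (l, snd (u k))))"
      if "u \<in> {1..K} \<rightarrow>\<^sub>E {0..1} \<times> {0..1}" "k \<in> {1..K}" "l \<in> {fst (u k)..1}" for u k l
      using that by (rule h[THEN conjunct2, rule_format])
  qed (rule finite_atLeastAtMost v_in)+
  then show ?thesis
    using Lv[of f] Lv[of f'] by (simp add: r_def)
qed


section \<open>Optimal learners\<close>

lemma learner_inj_on: "learner C A \<Longrightarrow> inj_on (positives D) (A D)"
  unfolding learner_def inj_on_def by blast

lemma learner_positives_subset: "positives D ` A D \<subseteq> {..length D}"
  using positives_le_length by blast

text \<open>The family \<open>C\<close> may be infinite, but counting positives embeds the output
  into a finite set. Hence some list enumerates the output, which gives \<open>call_learner\<close>
  a run.\<close>

lemma learner_finite: "learner C A \<Longrightarrow> finite (A D)"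
  by (rule inj_on_finite[OF learner_inj_on learner_positives_subset finite_atMost])

lemma learner_card:
  assumes "learner C A"
  shows "card (A D) \<le> length D + 1"
  using card_inj_on_le[OF learner_inj_on[OF assms] learner_positives_subset[of D A]] by simp

text \<open>The classifier \<open>c'\<close> itself witnesses that its number of positives is
  achievable, so the learner returns a competitor with the same number and minimal error.\<close>

lemma optimal_learner_dominates:
  assumes "optimal_learner C A" "c' \<in> C"
  shows "\<exists>c\<in>A D. positives D c = positives D c' \<and> errors D c \<le> errors D c'"
proof -
  have P: "positives D c' \<in> positives D ` C"
    using assms(2) by simp
  then obtain c where c: "c \<in> A D" "positives D c = positives D c'"
    using assms(1) unfolding optimal_learner_def by blast
  moreover have "errors D c \<le> errors D c'"
    using assms P c unfolding optimal_learner_def by blast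
  ultimately show ?thesis
    by blast
qed

lemma learned_loss_le:
  assumes g: "grouping K X" and mon: "monotonic K L" and A: "optimal_learner C A"
    and ne: "\<And>k. k \<in> {1..K} \<Longrightarrow> group_sample (X k) S \<noteq> []"
    and f': "f' \<in> {1..K} \<rightarrow>\<^sub>E C"
  shows "\<exists>f \<in> (\<Pi>\<^sub>E k\<in>{1..K}. A (group_sample (X k) S)).
    L (records K X S (decoupled K X f)) \<le> L (records K X S (decoupled K X f'))"
proof -
  let ?D = "\<lambda>k. group_sample (X k) S"
  have "\<forall>k\<in>{1..K}. \<exists>c\<in>A (?D k).
      positives (?D k) c = positives (?D k) (f' k) \<and> errors (?D k) c \<le> errors (?D k) (f' k)"
    using optimal_learner_dominates[OF A PiE_mem[OF f']] by blast
  then obtain f0 where f0: "\<And>k. k \<in> {1..K} \<Longrightarrow> f0 k \<in> A (?D k) \<and>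
      positives (?D k) (f0 k) = positives (?D k) (f' k) \<and>
      errors (?D k) (f0 k) \<le> errors (?D k) (f' k)"
    by metis
  \<comment> \<open>Restriction supplies the value \<open>undefined\<close> outside
    \<open>{1..K}\<close> that membership in the product demands.\<close>
  define f where "f = restrict f0 {1..K}"
  have "f \<in> (\<Pi>\<^sub>E k\<in>{1..K}. A (?D k))"
    using f0 unfolding f_def by (intro restrict_PiE_iff[THEN iffD2]) blast
  moreover have "L (records K X S (decoupled K X f)) \<le> L (records K X S (decoupled K X f'))"
    using f0 by (intro joint_loss_mono[OF g mon ne]) (auto simp: f_def)
  ultimately show ?thesis
    by blast
qed


section \<open>Running Decouple\<close>

lemma runs_within_split_off:
  "runs_within (split_off Xk S) (3 * length S) ((=) (group_sample Xk S))"
proof -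
  \<comment> \<open>Per example: a membership test, possibly an extension, and the loop
    step.\<close>
  have "runs_within (split_off Xk S) (length S * (2 + 1)) ((=) (group_sample Xk ([] @ S)))"
    unfolding split_off_def
    by (rule runs_within_foreach[where I = "\<lambda>ys D. group_sample Xk ys = D"])
      (auto simp: group_sample_def intro!: runs_within_bind_steps_diff runs_within_steps)
  then show ?thesis
    by (simp add: mult.commute)
qed

lemma runs_within_learn_groups:
  assumes A: "learner C A" and TA: "\<And>k. k \<in> {1..K} \<Longrightarrow> tA (group_sample (X k) S) \<le> TA"
  shows "runs_within (learn_groups K X A tA S) (K * (3 * length S + TA + 2))
    (\<lambda>Cs. \<forall>k\<in>{1..K}. distinct (Cs k) \<and> set (Cs k) = A (group_sample (X k) S))"
proof -
  define I where "I ks Cs \<longleftrightarrow>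
    (\<forall>k\<in>set ks. distinct (Cs k) \<and> set (Cs k) = A (group_sample (X k) S))" for ks Cs
  have call: "runs_within (call_learner A tA D) (tA D) (\<lambda>cs. distinct cs \<and> set cs = A D)" for D
    using finite_distinct_list[OF learner_finite[OF A, of D]]
    by (auto simp: runs_within_def call_learner_def)
  \<comment> \<open>Per group: splitting off the sample, the call of the learner, one array update
    and the loop step.\<close>
  have "runs_within (learn_groups K X A tA S)
      (length [1..<Suc K] * (3 * length S + (TA + 1) + 1)) (I ([] @ [1..<Suc K]))"
    unfolding learn_groups_def
  proof (rule runs_within_foreach)
    fix ks k Cs
    assume k: "k \<in> set [1..<Suc K]" and I: "I ks Cs"
    have "runs_within (call_learner A tA (group_sample (X k) S)) TA
        (\<lambda>cs. distinct cs \<and> set cs = A (group_sample (X k) S))"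
      by (rule runs_within_mono[OF call]) (use TA k in auto)
    then have "runs_within (run_bind (call_learner A tA (group_sample (X k) S))
        (\<lambda>cs. steps 1 (Cs(k := cs)))) (TA + 1) (I (ks @ [k]))"
      by (rule runs_within_bind) (use I in \<open>auto simp: I_def intro!: runs_within_steps\<close>)
    then show "runs_within (run_bind (split_off (X k) S) (\<lambda>D. run_bind (call_learner A tA D)
        (\<lambda>cs. steps 1 (Cs(k := cs))))) (3 * length S + (TA + 1)) (I (ks @ [k]))"
      by (intro runs_within_bind[OF runs_within_split_off]) auto
  qed (simp add: I_def)
  then show ?thesis
    by (rule runs_within_mono) (auto simp: I_def)
qed

lemma runs_within_classify:
  assumes TC: "\<And>x y. (x, y) \<in> set S \<Longrightarrow> tC (c (group K X x)) x \<le> TC"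
  shows "runs_within (classify K X tC S c) (length S * (K + TC + 3))
    ((=) (records K X S (decoupled K X c)))"
proof -
  \<comment> \<open>Per example: \<open>K\<close> membership tests, one array access, the call of
    the classifier, one extension and the loop step.\<close>
  have "runs_within (classify K X tC S c) (length S * ((K + (1 + (TC + 1))) + 1))
      ((=) (records K X ([] @ S) (decoupled K X c)))"
    unfolding classify_def
  proof (rule runs_within_foreach[where I = "\<lambda>ys s. records K X ys (decoupled K X c) = s"])
    fix ys p s
    assume "p \<in> set S" and s: "records K X ys (decoupled K X c) = s"
    obtain x y where p: "p = (x, y)" by (cases p)
    then have "tC (c (group K X x)) x \<le> TC"
      using TC \<open>p \<in> set S\<close> by simp
    with p s show "runs_within ((case p of (x, y) \<Rightarrow> \<lambda>s. run_bind (steps K (group K X x))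
        (\<lambda>g. run_bind (steps 1 (c g)) (\<lambda>c'. run_bind (steps (tC c' x) (c' x))
        (\<lambda>z. steps 1 (s @ [(g, y, z)]))))) s) (K + (1 + (TC + 1)))
        ((=) (records K X (ys @ [p]) (decoupled K X c)))"
      by (auto simp: records_def decoupled_def
          intro!: runs_within_bind_steps_diff runs_within_steps)
  qed (simp add: records_def)
  then show ?thesis
    by (simp add: numeral_3_eq_3)
qed

text \<open>The instance of the invariant \<open>J\<close> in \<open>runs_within_search\<close>:
  \<open>V\<close> holds the candidates tried and \<open>b\<close> is the state of the
  search.\<close>

definition best_of ::
  "('c \<Rightarrow> real) \<Rightarrow> 'c set \<Rightarrow> ('c \<times> real) option \<Rightarrow> bool" where
  "best_of F V b \<longleftrightarrow>
     (case b of None \<Rightarrow> V = {} | Some (c, v) \<Rightarrow> c \<in> V \<and> v = F c \<and> (\<forall>c'\<in>V. F c \<le> F c'))"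

lemma runs_within_try_candidate:
  assumes TC: "\<And>x y. (x, y) \<in> set S \<Longrightarrow> tC (c (group K X x)) x \<le> TC"
    and TL: "tL (records K X S (decoupled K X c)) \<le> TL"
    and best: "best_of (\<lambda>c. L (records K X S (decoupled K X c))) V best"
  shows "runs_within (try_candidate K X L tL tC S c best) (length S * (K + TC + 3) + TL + K + 1)
    (best_of (\<lambda>c. L (records K X S (decoupled K X c))) (insert c V))"
proof -
  let ?r = "records K X S (decoupled K X c)"
  let ?Q = "best_of (\<lambda>c. L (records K X S (decoupled K X c))) (insert c V)"
  let ?update = "\<lambda>v. case best of None \<Rightarrow> steps K (Some (c, v))
      | Some (c0, v0) \<Rightarrow> run_bind (steps 1 (v < v0, v = v0)) (\<lambda>cmp.
          if fst cmp then steps K (Some (c, v))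
          else if snd cmp then steps 0 best \<union> steps K (Some (c, v))
          else steps 0 best)"
  \<comment> \<open>The budget is one comparison and \<open>K\<close> steps for copying a
    candidate.\<close>
  have update: "runs_within (?update (L ?r)) (1 + K) ?Q"
  proof (cases best)
    case None
    then show ?thesis
      using best by (auto simp: best_of_def intro!: runs_within_steps)
  next
    case (Some p)
    let ?F = "\<lambda>c. L (records K X S (decoupled K X c))"
    obtain c0 where c0: "best = Some (c0, ?F c0)" "c0 \<in> V" "\<forall>c'\<in>V. ?F c0 \<le> ?F c'"
      using best Some by (auto simp: best_of_def)
    \<comment> \<open>The facts \<open>new\<close> and \<open>old\<close> overlap when the values
      are equal, so both outcomes of an arbitrary tie-break are covered.\<close>
    have new: "?Q (Some (c, ?F c))" if "?F c \<le> ?F c0"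
      using c0 order.trans[OF that] by (auto simp: best_of_def)
    have old: "?Q best" if "?F c0 \<le> ?F c"
      using c0 that by (auto simp: best_of_def)
    show ?thesis
      using new old unfolding c0(1)
      by (auto intro!: runs_within_bind_steps_diff runs_within_steps runs_within_union)
  qed
  have "runs_within (run_bind (steps (tL ?r) (L ?r)) ?update) (TL + (1 + K)) ?Q"
    using update TL by (intro runs_within_bind_steps[where t = "1 + K"]) simp_all
  moreover have "runs_within (classify K X tC S c) (length S * (K + TC + 3)) ((=) ?r)"
    using TC by (rule runs_within_classify)
  ultimately show ?thesis
    unfolding try_candidate_def by (intro runs_within_bind[where P = "(=) ?r"]) auto
qed

text \<open>Minimality is asserted here over the learned candidates only. The cost bounds likewise
  concern only learned classifiers, of which there are finitely many, so that such bounds always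
  exist.\<close>

lemma runs_within_decouple:
  assumes g: "grouping K X" and A: "learner C A"
    and TA: "\<And>k. k \<in> {1..K} \<Longrightarrow> tA (group_sample (X k) S) \<le> TA"
    and TL: "\<And>f. f \<in> (\<Pi>\<^sub>E k\<in>{1..K}. A (group_sample (X k) S)) \<Longrightarrow>
      tL (records K X S (decoupled K X f)) \<le> TL"
    and TC: "\<And>k c x y. k \<in> {1..K} \<Longrightarrow> c \<in> A (group_sample (X k) S) \<Longrightarrow> (x, y) \<in> set S \<Longrightarrow>
      tC c x \<le> TC"
  shows "runs_within (decouple K X L tL tC A tA S)
    (K * (3 * length S + TA + 2) +
      ((length S + 1) ^ K * (length S * (K + TC + 3) + TL + K + 1 + 3 * K) + 1))
    (\<lambda>c. \<exists>f \<in> (\<Pi>\<^sub>E k\<in>{1..K}. A (group_sample (X k) S)). c = decoupled K X f \<and>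
      (\<forall>f' \<in> (\<Pi>\<^sub>E k\<in>{1..K}. A (group_sample (X k) S)).
        L (records K X S c) \<le> L (records K X S (decoupled K X f'))))"
    (is "runs_within _ _ ?Q")
proof -
  let ?W = "\<Pi>\<^sub>E k\<in>{1..K}. A (group_sample (X k) S)"
  let ?F = "\<lambda>f. L (records K X S (decoupled K X f))"
  let ?B = "length S * (K + TC + 3) + TL + K + 1"
  let ?T = "(length S + 1) ^ K * (?B + 3 * K)"
  \<comment> \<open>At least one candidate is tried, so the final state is not \<open>None\<close>
    and \<open>the\<close> is applied to a genuine result.\<close>
  have "?W \<noteq> {}"
    using A by (auto simp: learner_def PiE_eq_empty_iff)
  have search: "runs_within (run_bind
      (search (try_candidate K X L tL tC S) Cs [1..<Suc K] (\<lambda>_. undefined) None)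
      (\<lambda>best. steps 1 (decoupled K X (fst (the best))))) (?T + 1) ?Q"
    if Cs: "\<forall>k\<in>{1..K}. distinct (Cs k) \<and> set (Cs k) = A (group_sample (X k) S)" for Cs
  proof (rule runs_within_bind)
    have W: "completions Cs [1..<Suc K] (\<lambda>_. undefined) = ?W"
      unfolding completions_upt_undefined using Cs by (intro PiE_cong) simp
    have "runs_within (search (try_candidate K X L tL tC S) Cs [1..<Suc K] (\<lambda>_. undefined) None)
        ((length S + 1) ^ length [1..<Suc K] * (?B + 3 * length [1..<Suc K]))
        (best_of ?F ({} \<union> completions Cs [1..<Suc K] (\<lambda>_. undefined)))"
    proof (rule runs_within_search)
      fix k
      assume "k \<in> set [1..<Suc K]"
      then have "length (Cs k) = card (A (group_sample (X k) S))"
        using Cs distinct_card[of "Cs k"] by auto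
      also have "\<dots> \<le> length (group_sample (X k) S) + 1"
        using A by (rule learner_card)
      also have "\<dots> \<le> length S + 1"
        by (simp add: group_sample_def)
      finally show "length (Cs k) \<le> length S + 1" .
    next
      fix V f s
      assume f: "f \<in> completions Cs [1..<Suc K] (\<lambda>_. undefined)" and "best_of ?F V s"
      show "runs_within (try_candidate K X L tL tC S f s) ?B (best_of ?F (insert f V))"
      proof (rule runs_within_try_candidate)
        have "f \<in> ?W"
          using f W by simp
        then show "tL (records K X S (decoupled K X f)) \<le> TL"
          by (rule TL)
        show "tC (f (group K X x)) x \<le> TC" if "(x, y) \<in> set S" for x y
          using TC[OF _ PiE_mem[OF \<open>f \<in> ?W\<close>] that] group_in(1)[OF g, of x] by blast
      qed fact
    qed (simp_all add: best_of_def)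
    then show "runs_within (search (try_candidate K X L tL tC S) Cs [1..<Suc K] (\<lambda>_. undefined) None)
        ?T (best_of ?F ?W)"
      by (simp only: W length_upt Un_empty_left) simp
    show "runs_within (steps 1 (decoupled K X (fst (the best)))) 1 ?Q" if "best_of ?F ?W best" for best
      using that \<open>?W \<noteq> {}\<close>
      by (intro runs_within_steps) (auto simp: best_of_def split: option.splits)
  qed simp
  show ?thesis
    unfolding decouple_def
  proof (rule runs_within_bind)
    show "runs_within (learn_groups K X A tA S) (K * (3 * length S + TA + 2))
        (\<lambda>Cs. \<forall>k\<in>{1..K}. distinct (Cs k) \<and> set (Cs k) = A (group_sample (X k) S))"
      using A TA by (rule runs_within_learn_groups)
  qed (fact search, rule order.refl)
qed


section \<open>The time bound\<close>

text \<open>With all coefficients equal to \<open>c\<close> the polynomial factors into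
  \<open>c\<close> and three sums of powers. Single terms bound these factors: degree
  \<open>d\<close> in \<open>u\<close>, degrees 0 and 1 in \<open>v\<close> and
  \<open>w\<close>.\<close>

lemma poly3_const_ge:
  assumes "1 \<le> d"
  shows "c * u ^ d * (1 + v) * (1 + w) \<le> poly3 d (\<lambda>_ _ _. c) u v w"
proof -
  have lin: "1 + x \<le> (\<Sum>j\<le>d. x ^ j)" for x :: nat
  proof -
    have "(\<Sum>j\<in>{0, 1}. x ^ j) \<le> (\<Sum>j\<le>d. x ^ j)"
      using assms by (intro sum_mono2) auto
    then show ?thesis by simp
  qed
  have "u ^ d \<le> (\<Sum>i\<le>d. u ^ i)"
    by (rule member_le_sum) auto
  then have "c * u ^ d * (1 + v) * (1 + w) \<le> c * (\<Sum>i\<le>d. u ^ i) * (\<Sum>j\<le>d. v ^ j) * (\<Sum>l\<le>d. w ^ l)"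
    by (intro mult_mono lin order.refl) auto
  also have "\<dots> = poly3 d (\<lambda>_ _ _. c) u v w"
    unfolding poly3_def by (simp add: sum_distrib_left sum_distrib_right mult_ac)
  finally show ?thesis .
qed

text \<open>The \<open>K\<close> calls of the learner give the linear term. Everything else is a
  multiple of the single monomial-like bound \<open>?m\<close>; since \<open>1 \<le> n\<close>, the
  factor \<open>(n + 1) ^ K\<close> costs only \<open>2 ^ K\<close>, and lower powers of
  \<open>n\<close> are absorbed.\<close>

lemma decouple_time_le:
  fixes K n TA TL TC :: nat
  assumes n: "1 \<le> n"
  shows "K * (3 * n + TA + 2) + ((n + 1) ^ K * (n * (K + TC + 3) + TL + K + 1 + 3 * K) + 1)
    \<le> K * TA + poly3 (K + 1) (\<lambda>_ _ _. 5 * K + 1 + 2 ^ K * (5 * K + 4)) n TL TC"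
proof -
  let ?m = "n ^ (K + 1) * ((1 + TL) * (1 + TC))"
  have n_le: "n \<le> ?m"
    using n mult_le_mono[of n "n ^ (K + 1)" 1 "(1 + TL) * (1 + TC)"] by simp
  have "(n + 1) ^ K \<le> (2 * n) ^ K"
    using n by (intro power_mono) auto
  moreover have "n * (K + TC + 3) + TL + K + 1 + 3 * K \<le> n * ((5 * K + 4) * ((1 + TL) * (1 + TC)))"
  proof -
    \<comment> \<open>Multiplying the part without \<open>n\<close> by \<open>n\<close> collects
      everything into \<open>5 * K + 4 + TL + TC\<close>, the source of the factor
      \<open>5 * K + 4\<close>.\<close>
    have "n * (K + TC + 3) + TL + K + 1 + 3 * K \<le> n * (K + TC + 3) + n * (TL + 4 * K + 1)"
      using mult_le_mono1[OF n, of "TL + 4 * K + 1"] by simp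
    also have "\<dots> = n * (5 * K + 4 + TL + TC)"
      by (simp add: algebra_simps)
    also have "\<dots> \<le> n * ((5 * K + 4) * ((1 + TL) * (1 + TC)))"
      by (intro mult_left_mono) (simp_all add: algebra_simps)
    finally show ?thesis .
  qed
  ultimately have "(n + 1) ^ K * (n * (K + TC + 3) + TL + K + 1 + 3 * K)
      \<le> (2 * n) ^ K * (n * ((5 * K + 4) * ((1 + TL) * (1 + TC))))"
    by (rule mult_le_mono)
  also have "\<dots> = 2 ^ K * (5 * K + 4) * ?m"
    by (simp add: power_mult_distrib algebra_simps)
  finally have search: "(n + 1) ^ K * (n * (K + TC + 3) + TL + K + 1 + 3 * K) \<le> 2 ^ K * (5 * K + 4) * ?m" .
  \<comment> \<open>Here \<open>3 * n + 2 \<le> 5 * n\<close> and \<open>1 \<le> n\<close> produce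
    the coefficient \<open>5 * K + 1\<close>.\<close>
  have learn: "K * (3 * n + 2) + 1 \<le> (5 * K + 1) * ?m"
  proof -
    have "K * (3 * n + 2) \<le> K * (5 * n)"
      using n by (intro mult_left_mono) auto
    then have "K * (3 * n + 2) + 1 \<le> K * (5 * n) + n"
      using n by (rule add_mono)
    also have "\<dots> = (5 * K + 1) * n"
      by (simp add: algebra_simps)
    also have "\<dots> \<le> (5 * K + 1) * ?m"
      using n_le by (rule mult_left_mono) simp
    finally show ?thesis .
  qed
  have split: "K * (3 * n + TA + 2) + (x + 1) = K * TA + (K * (3 * n + 2) + 1 + x)" for x
    by (simp add: algebra_simps)
  have poly: "(5 * K + 1) * ?m + 2 ^ K * (5 * K + 4) * ?m
      \<le> poly3 (K + 1) (\<lambda>_ _ _. 5 * K + 1 + 2 ^ K * (5 * K + 4)) n TL TC"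
    using poly3_const_ge[of "K + 1" "5 * K + 1 + 2 ^ K * (5 * K + 4)" n TL TC]
    by (simp only: add_mult_distrib mult.assoc)
  show ?thesis
    unfolding split by (intro add_left_mono order.trans[OF add_mono[OF learn search] poly])
qed

lemma finite_nat_bound:
  fixes f :: "'a \<Rightarrow> nat"
  assumes "finite I"
  shows "\<exists>m. \<forall>i\<in>I. f i \<le> m"
  using assms by (intro exI[of _ "Max (f ` I)"]) simp

text \<open>The order of quantifiers expresses constant \<open>K\<close>: the numbers
  \<open>a\<close>, \<open>d\<close> and \<open>q\<close> are chosen before the groups, the data and
  the cost functions. Optimality is kept outside the implication about time, so it is independent of
  any given cost bounds.\<close>

theorem theorem2:
  fixes K :: nat
  shows "\<exists>(a :: nat) (d :: nat) (q :: nat \<Rightarrow> nat \<Rightarrow> nat \<Rightarrow> nat).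
    \<forall>(X :: nat \<Rightarrow> 'x set) (C :: 'x classifier set) (L :: joint_loss) (A :: 'x sample \<Rightarrow> 'x classifier set)
     (tL :: datum list \<Rightarrow> nat) (tC :: 'x classifier \<Rightarrow> 'x \<Rightarrow> nat) (tA :: 'x sample \<Rightarrow> nat)
     (S :: 'x sample).
      grouping K X \<and> monotonic K L \<and> optimal_learner C A \<and>
      (\<forall>k\<in>{1..K}. group_sample (X k) S \<noteq> []) \<longrightarrow>
        decouple K X L tL tC A tA S \<noteq> {} \<and>
        (\<forall>(c, t) \<in> decouple K X L tL tC A tA S.
           c \<in> decoupled_classifiers K X C \<and>
           (\<forall>c' \<in> decoupled_classifiers K X C. L (records K X S c) \<le> L (records K X S c')) \<and>
           (\<forall>TA TL TC.
              (\<forall>k\<in>{1..K}. tA (group_sample (X k) S) \<le> TA) \<and>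
              (\<forall>c' \<in> decoupled_classifiers K X C. tL (records K X S c') \<le> TL) \<and>
              (\<forall>c'\<in>C. \<forall>(x, y) \<in> set S. tC c' x \<le> TC) \<longrightarrow>
              t \<le> a * TA + poly3 d q (length S) TL TC))"
proof (intro exI allI impI)
  fix X :: "nat \<Rightarrow> 'x set" and C :: "'x classifier set" and L :: joint_loss
    and A :: "'x sample \<Rightarrow> 'x classifier set" and tL :: "datum list \<Rightarrow> nat"
    and tC :: "'x classifier \<Rightarrow> 'x \<Rightarrow> nat" and tA :: "'x sample \<Rightarrow> nat" and S :: "'x sample"
  assume "grouping K X \<and> monotonic K L \<and> optimal_learner C A \<and>
    (\<forall>k\<in>{1..K}. group_sample (X k) S \<noteq> [])"
  then have g: "grouping K X" and mon: "monotonic K L" and A: "optimal_learner C A"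
    and ne: "\<And>k. k \<in> {1..K} \<Longrightarrow> group_sample (X k) S \<noteq> []"
    by auto
  have lA: "learner C A"
    using A by (simp add: optimal_learner_def)
  \<comment> \<open>Every example has a group in \<open>{1..K}\<close>, so there is at least one
    group, and its sample is nonempty.\<close>
  have "S \<noteq> []"
    using ne[OF group_in(1)[OF g]] by (auto simp: group_sample_def)
  then have n: "1 \<le> length S"
    by (simp add: Suc_le_eq)
  let ?W = "\<Pi>\<^sub>E k\<in>{1..K}. A (group_sample (X k) S)"
  let ?optimal = "\<lambda>c. \<exists>f\<in>?W. c = decoupled K X f \<and>
      (\<forall>f'\<in>?W. L (records K X S c) \<le> L (records K X S (decoupled K X f')))"
  let ?time = "\<lambda>TA TL TC. K * (3 * length S + TA + 2) +
      ((length S + 1) ^ K * (length S * (K + TC + 3) + TL + K + 1 + 3 * K) + 1)"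
  have W: "?W \<subseteq> {1..K} \<rightarrow>\<^sub>E C"
    using lA by (intro PiE_mono) (simp add: learner_def)
  have fin: "finite (A D)" for D
    using lA by (rule learner_finite)

  \<comment> \<open>Maxima over the finitely many learned objects serve as bounds, so that
    \<open>runs_within_decouple\<close> applies for arbitrary cost functions; from this instance
    only existence of a run and optimality are used.\<close>
  obtain TA where TA: "k \<in> {1..K} \<Longrightarrow> tA (group_sample (X k) S) \<le> TA" for k
    using finite_nat_bound[of "{1..K}" "\<lambda>k. tA (group_sample (X k) S)"] by blast
  have "finite ?W"
    using fin by (intro finite_PiE) simp_all
  from finite_nat_bound[OF this, of "\<lambda>f. tL (records K X S (decoupled K X f))"]
  obtain TL where "\<forall>f\<in>?W. tL (records K X S (decoupled K X f)) \<le> TL" ..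
  then have TL: "tL (records K X S (decoupled K X f)) \<le> TL" if "f \<in> ?W" for f
    using that by (rule bspec)
  have "finite ((\<Union>k\<in>{1..K}. A (group_sample (X k) S)) \<times> set S)"
    using fin by simp
  from finite_nat_bound[OF this, of "\<lambda>(c, x, y). tC c x"] obtain TC where
    "\<forall>p \<in> (\<Union>k\<in>{1..K}. A (group_sample (X k) S)) \<times> set S. (case p of (c, x, y) \<Rightarrow> tC c x) \<le> TC"
    ..
  then have TC: "tC c x \<le> TC"
    if "k \<in> {1..K}" "c \<in> A (group_sample (X k) S)" "(x, y) \<in> set S" for k c x y
    using that by fastforce
  have correct: "runs_within (decouple K X L tL tC A tA S) (?time TA TL TC) ?optimal"
    using g lA TA TL TC by (rule runs_within_decouple)

  \<comment> \<open>The witnesses for \<open>a\<close>, \<open>d\<close> and \<open>q\<close> are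
    fixed here: \<open>K\<close>, \<open>K + 1\<close> and the constant coefficient from
    \<open>decouple_time_le\<close>, all depending on \<open>K\<close> alone.\<close>
  show "decouple K X L tL tC A tA S \<noteq> {} \<and>
    (\<forall>(c, t) \<in> decouple K X L tL tC A tA S.
       c \<in> decoupled_classifiers K X C \<and>
       (\<forall>c' \<in> decoupled_classifiers K X C. L (records K X S c) \<le> L (records K X S c')) \<and>
       (\<forall>TA TL TC.
          (\<forall>k\<in>{1..K}. tA (group_sample (X k) S) \<le> TA) \<and>
          (\<forall>c' \<in> decoupled_classifiers K X C. tL (records K X S c') \<le> TL) \<and>
          (\<forall>c'\<in>C. \<forall>(x, y) \<in> set S. tC c' x \<le> TC) \<longrightarrow>
          t \<le> K * TA + poly3 (K + 1) (\<lambda>_ _ _. 5 * K + 1 + 2 ^ K * (5 * K + 4)) (length S) TL TC))"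
  proof (intro conjI ballI case_prodI2 allI impI)
    show "decouple K X L tL tC A tA S \<noteq> {}"
      using correct by (auto simp: runs_within_def)
  next
    fix p c t
    assume "p \<in> decouple K X L tL tC A tA S" "p = (c, t)"
    with runs_withinD[OF correct] have "?optimal c"
      by blast
    then obtain f where f: "f \<in> ?W" "c = decoupled K X f"
      and min: "\<forall>f'\<in>?W. L (records K X S c) \<le> L (records K X S (decoupled K X f'))"
      by (elim bexE conjE)
    show "c \<in> decoupled_classifiers K X C"
      unfolding f(2) decoupled_classifiers_def using subsetD[OF W f(1)] by (rule imageI)
    fix c'
    assume "c' \<in> decoupled_classifiers K X C"
    then obtain f' where f': "f' \<in> {1..K} \<rightarrow>\<^sub>E C" "c' = decoupled K X f'"
      by (auto simp: decoupled_classifiers_def)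
    \<comment> \<open>The link from all decoupled classifiers to the learned ones:
      \<open>f''\<close> does at least as well as \<open>c'\<close>, and the output does at least as
      well as \<open>f''\<close>.\<close>
    have "\<exists>f''\<in>?W. L (records K X S (decoupled K X f'')) \<le> L (records K X S c')"
      unfolding f'(2) using g mon A ne f'(1) by (rule learned_loss_le)
    then obtain f'' where "f'' \<in> ?W"
      "L (records K X S (decoupled K X f'')) \<le> L (records K X S c')" ..
    with bspec[OF min this(1)] show "L (records K X S c) \<le> L (records K X S c')"
      by linarith
  next
    fix p c t TA TL TC
    assume p: "p \<in> decouple K X L tL tC A tA S" "p = (c, t)"
      and bounds: "(\<forall>k\<in>{1..K}. tA (group_sample (X k) S) \<le> TA) \<and>
        (\<forall>c' \<in> decoupled_classifiers K X C. tL (records K X S c') \<le> TL) \<and>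
        (\<forall>c'\<in>C. \<forall>(x, y) \<in> set S. tC c' x \<le> TC)"
    have TA: "tA (group_sample (X k) S) \<le> TA" if "k \<in> {1..K}" for k
      using bounds that by blast
    have TL: "tL (records K X S (decoupled K X f)) \<le> TL" if "f \<in> ?W" for f
    proof (rule bspec[OF bounds[THEN conjunct2, THEN conjunct1]])
      show "decoupled K X f \<in> decoupled_classifiers K X C"
        unfolding decoupled_classifiers_def using subsetD[OF W that] by (rule imageI)
    qed
    have TC: "tC c x \<le> TC" if "c \<in> A (group_sample (X k) S)" "(x, y) \<in> set S" for k c x y
      using that bounds lA unfolding learner_def by fast
    \<comment> \<open>The analysis is applied again with the given bounds, which cover the learned
      classifiers because these lie in \<open>C\<close>.\<close>
    have "runs_within (decouple K X L tL tC A tA S) (?time TA TL TC) ?optimal"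
      using g lA TA TL TC by (rule runs_within_decouple)
    from runs_withinD[OF this] p have "t \<le> ?time TA TL TC"
      by blast
    also note decouple_time_le[OF n]
    finally show "t \<le> K * TA +
        poly3 (K + 1) (\<lambda>_ _ _. 5 * K + 1 + 2 ^ K * (5 * K + 4)) (length S) TL TC" .
  qed
qed

end
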